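(* Let $G$ be a connected chordal graph, let $P_0$ be a simple path in $G$, and let $G_3$ be the graph obtained from $G$ by removing all edges on $P_0$. (1) If $(P_0)_{i,j}$ ($0\le i<j<|P_0|$) is a separator path, then in $G_3$ all vertices with odd index on $(P_0)_{i,j}$ belong to one connected component $C_o$, and all vertices with even index on $(P_0)_{i,j}$ belong to one connected component $C_e$ different from $C_o$. (2) Conversely, for $0\le i<j<|P_0|$, if in $G_3$ all vertices with odd index on $(P_0)_{i,j}$ belong to one connected component $C_o$ and all vertices with even index on $(P_0)_{i,j}$ belong to a different connected component $C_e$, and there is no subpath $(P_0)_{x,y}$ ($0\le x<y<|P_0|$) other than $(P_0)_{i,j}$ containing $(P_0)_{i,j}$ for which the same condition holds, then $(P_0)_{i,j}$ is a separator path.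
   Context: A chordal graph is a simple undirected graph in which every cycle with four or more vertices has a chord. A path $p=p_0,\dots,p_{|p|-1}$ is a sequence of vertices with consecutive vertices adjacent; it is simple if its vertices are distinct; $p_{i,j}$ is the subpath $p_i,\dots,p_j$ (whose vertices are indexed $0,\dots,j-i$); $p$ contains $q$ if $q=p_{i,j}$ for some $i\le j$. A path is separating if removing all its edges disconnects $G$. A separator path is a simple separating path not containing any separating path other than itself. *)

theory Defs
  imports "Graph_Theory.Graph_Theory"
begin

(* A simple undirected graph is a pair_bidirected_digraph: each edge is represented by its two
   opposite arcs, there are no loops, and the vertex set may be infinite.
   Every 2-arc closed walk u, v, u counts as a library cycle, but a library cycle with at least
   three arcs is a cycle of the undirected graph, and the number of its arcs is the number of its
   vertices. The vertices of c are the tails of its arcs. *)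
definition chordal :: "'a pair_pre_digraph \<Rightarrow> bool" where
  "chordal G \<longleftrightarrow> pair_bidirected_digraph G \<and>
    (\<forall>c. pre_digraph.cycle G c \<and> length c \<ge> 4 \<longrightarrow>
      (\<exists>u \<in> fst ` set c. \<exists>v \<in> fst ` set c.
        (u, v) \<in> parcs G \<and> (u, v) \<notin> set c \<and> (v, u) \<notin> set c))"

(* Paths are the library's vertex walks (vwalk), simple paths are vpath. *)

(* For i \<le> j < length p this is the list p ! i, ..., p ! j. *)
definition subpath :: "'a list \<Rightarrow> nat \<Rightarrow> nat \<Rightarrow> 'a list" where
  "subpath p i j = take (Suc j - i) (drop i p)"

definition path_contains :: "'a list \<Rightarrow> 'a list \<Rightarrow> bool" where
  "path_contains p q \<longleftrightarrow> (\<exists>i j. i \<le> j \<and> j < length p \<and> q = subpath p i j)"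

(* Both arcs of each edge of p are removed; all vertices are kept. *)
definition remove_path_edges :: "'a pair_pre_digraph \<Rightarrow> 'a list \<Rightarrow> 'a pair_pre_digraph" where
  "remove_path_edges G p =
    G\<lparr>parcs := parcs G - (set (vwalk_arcs p) \<union> (set (vwalk_arcs p))\<inverse>)\<rparr>"

definition separating_path :: "'a pair_pre_digraph \<Rightarrow> 'a list \<Rightarrow> bool" where
  "separating_path G p \<longleftrightarrow> vwalk p G \<and> \<not> connected (remove_path_edges G p)"

definition separator_path :: "'a pair_pre_digraph \<Rightarrow> 'a list \<Rightarrow> bool" where
  "separator_path G p \<longleftrightarrow> vpath p G \<and> separating_path G p \<and>
    (\<forall>q. path_contains p q \<and> separating_path G q \<longrightarrow> q = p)"

(* Since both arcs of every edge are present, the strongly connected components (sccs) are the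
   connected components of the undirected graph. *)
definition parity_split :: "'a pair_pre_digraph \<Rightarrow> 'a list \<Rightarrow> bool" where
  "parity_split H q \<longleftrightarrow>
    (\<exists>Co \<in> pre_digraph.sccs H. \<exists>Ce \<in> pre_digraph.sccs H. Co \<noteq> Ce \<and>
      (\<forall>k < length q. odd k \<longrightarrow> q ! k \<in> verts Co) \<and>
      (\<forall>k < length q. even k \<longrightarrow> q ! k \<in> verts Ce))"

end

(* If F is a set of edges of a chordal graph such that every triangle contains an even number of
   its members, then so does every closed walk: a chord splits a long cycle into two shorter closed
   walks. Hence F is a cut, and if F is nonempty and lies on a path then the path separates.

   (1) Let D be the cut between the two sides left by removing a separator path q. If some inner
   vertex q_m did not have both its path edges in D and q_(m-1) adjacent to q_(m+1), then one of the
   parts of D before and after q_m would be a nonempty cut on a shorter path, against minimality. So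
   all edges of q cross, and vertices two steps apart on q are joined by an edge off the path.
   (2) Let D be the set of edges between C_o and C_e. No triangle has all three edges on a path, so D
   meets every triangle evenly; by maximality the path edges just outside of q are not in D, so its
   part on q is again a cut. It is minimal, since any edge of q that is kept reconnects C_o and C_e. *)

theory Submission
  imports Defs
begin

section \<open>Arc lists of vertex walks\<close>

lemma chordal_pair_bidirected: "chordal G \<Longrightarrow> pair_bidirected_digraph G"
  by (simp add: chordal_def)

lemma pair_bidirected_facts:
  assumes "pair_bidirected_digraph G"
  shows "sym (parcs G)" "irrefl (parcs G)" "parcs G \<subseteq> pverts G \<times> pverts G"
proof -
  interpret pair_bidirected_digraph G by fact
  show "sym (parcs G)" using pair_sym_arcs by (simp add: symmetric_def)
  show "irrefl (parcs G)" using pair_no_loops by (force simp: irrefl_def)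
  show "parcs G \<subseteq> pverts G \<times> pverts G" using arc_fst_in_verts arc_snd_in_verts by force
qed

lemma set_vwalk_arcs_conv_nth:
  "set (vwalk_arcs p) = {(p ! k, p ! Suc k) |k. Suc k < length p}"
proof (induction p rule: vwalk_arcs.induct)
  case (3 x y xs)
  have "{((x # y # xs) ! k, (x # y # xs) ! Suc k) |k. Suc k < length (x # y # xs)}
    = insert (x, y) {((y # xs) ! k, (y # xs) ! Suc k) |k. Suc k < length (y # xs)}"
    (is "?L = ?R")
  proof (intro set_eqI iffI)
    fix e assume "e \<in> ?L"
    then obtain k where "e = ((x # y # xs) ! k, (x # y # xs) ! Suc k)"
      "Suc k < length (x # y # xs)" by blast
    then show "e \<in> ?R" by (cases k) auto
  next
    fix e assume "e \<in> ?R"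
    then consider "e = (x, y)"
      | k where "e = ((y # xs) ! k, (y # xs) ! Suc k)" "Suc k < length (y # xs)" by blast
    then show "e \<in> ?L"
    proof cases
      case 1 then show ?thesis by (intro CollectI exI[of _ 0]) simp
    next
      case (2 k) then show ?thesis by (intro CollectI exI[of _ "Suc k"]) simp
    qed
  qed
  with 3 show ?case by simp
qed simp_all

text \<open>Cuts a walk at a vertex shared by both pieces, so that counts of arcs add up; it serves
  to split closed walks at a repeated vertex or at the ends of a chord.\<close>

lemma vwalk_arcs_append_single:
  "vwalk_arcs (xs @ v # ys) = vwalk_arcs (xs @ [v]) @ vwalk_arcs (v # ys)"
  by (induction xs rule: vwalk_arcs.induct) (cases ys; auto)+

lemma rtrancl_imp_vwalk_arcs:
  assumes "(u, v) \<in> R\<^sup>*"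
  shows "\<exists>xs. xs \<noteq> [] \<and> hd xs = u \<and> last xs = v \<and> set (vwalk_arcs xs) \<subseteq> R"
  using assms
proof (induction rule: converse_rtrancl_induct)
  case base
  show ?case by (intro exI[of _ "[v]"]) simp
next
  case (step x y)
  then obtain xs where "xs \<noteq> []" "hd xs = y" "last xs = v" "set (vwalk_arcs xs) \<subseteq> R" by blast
  with step show ?case by (intro exI[of _ "x # xs"]) simp
qed

lemma pcas_vwalk_arcs: "xs \<noteq> [] \<Longrightarrow> pcas (hd xs) (vwalk_arcs xs) (last xs)"
  by (induction xs rule: vwalk_arcs.induct) auto

lemma pawalk_verts_vwalk_arcs: "xs \<noteq> [] \<Longrightarrow> pawalk_verts (hd xs) (vwalk_arcs xs) = xs"
  by (induction xs rule: vwalk_arcs.induct) auto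

lemma fst_set_vwalk_arcs: "fst ` set (vwalk_arcs xs) = set (butlast xs)"
  by (induction xs rule: vwalk_arcs.induct) auto

lemma length_vwalk_arcs: "length (vwalk_arcs xs) = length xs - 1"
  by (induction xs rule: vwalk_arcs.induct) auto

text \<open>Brings closed vertex lists into the form to which \<open>chordal\<close> applies. The
  first vertex recurs at the end of \<open>xs\<close>, hence distinctness of \<open>tl xs\<close>;
  length at least 2 provides an arc.\<close>

lemma cycle_vwalk_arcs:
  assumes "pair_wf_digraph G" "set (vwalk_arcs xs) \<subseteq> parcs G" "hd xs = last xs"
    "distinct (tl xs)" "2 \<le> length xs"
  shows "pre_digraph.cycle (with_proj G) (vwalk_arcs xs)"
proof -
  interpret pair_wf_digraph G by fact
  obtain x y ys where xs: "xs = x # y # ys"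
    using assms(5) by (cases xs; cases "tl xs") auto
  show ?thesis
    unfolding cycle_def awalk_def
    using assms pcas_vwalk_arcs[of xs] pawalk_verts_vwalk_arcs[of xs]
    by (intro exI[of _ "hd xs"]) (auto simp: xs dest: in_arcsD1)
qed

section \<open>Cuts in chordal graphs\<close>

text \<open>A triangle with one edge in \<open>F\<close> has exactly one further edge there, so
  every triangle has zero or two: the local form of being a cut. \<open>F\<close> holds both arcs of
  each of its edges.\<close>

definition even_on_triangles :: "'a rel \<Rightarrow> 'a rel \<Rightarrow> bool" where
  "even_on_triangles E F \<longleftrightarrow> F \<subseteq> E \<and> sym F \<and>
    (\<forall>u v w. (u, v) \<in> F \<and> (v, w) \<in> E \<and> (w, u) \<in> E \<longrightarrow> ((v, w) \<in> F) \<noteq> ((w, u) \<in> F))"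

abbreviation arcs_in :: "'a rel \<Rightarrow> 'a list \<Rightarrow> nat" where
  "arcs_in F xs \<equiv> length (filter (\<lambda>e. e \<in> F) (vwalk_arcs xs))"

text \<open>Induction on the length. A repeated vertex or a chord yields two shorter closed walks; a
  chord is counted once in each of them and so cancels modulo 2. What remains are closed walks of at
  most three arcs.\<close>

lemma closed_walk_chord_parity:
  assumes ch: "chordal G" and F: "even_on_triangles (parcs G) F"
    and "xs \<noteq> []" "hd xs = last xs" "set (vwalk_arcs xs) \<subseteq> parcs G"
  shows "even (arcs_in F xs)"
  using assms(3-)
proof (induction xs rule: length_induct)
  case (1 xs)
  let ?E = "parcs G"
  note IH = 1(1) and ne = 1(2) and closed = 1(3) and walk = 1(4)
  interpret pair_bidirected_digraph G by (rule chordal_pair_bidirected[OF ch])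
  have symE: "sym ?E" and irr: "irrefl ?E"
    using pair_bidirected_facts chordal_pair_bidirected[OF ch] by blast+
  have symF: "sym F" using F by (simp add: even_on_triangles_def)
  show ?case
  proof (cases "distinct (tl xs)")
    case False
    \<comment> \<open>The repeated vertex \<open>u\<close> pinches off the closed walk
      \<open>u # b @ [u]\<close>. Since \<open>a\<close> is nonempty, this walk is strictly shorter
      and the remaining walk keeps its first vertex.\<close>
    then obtain a0 b c u where "tl xs = a0 @ [u] @ b @ [u] @ c"
      using not_distinct_decomp by blast
    then obtain x a where xs: "xs = a @ u # b @ u # c" and a: "a = x # a0"
      using ne by (cases xs) auto
    have s1: "vwalk_arcs xs = vwalk_arcs (a @ [u]) @ vwalk_arcs (u # b @ [u]) @ vwalk_arcs (u # c)"
      using vwalk_arcs_append_single[of a u "b @ u # c"]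
        vwalk_arcs_append_single[of "u # b" u c] by (simp add: xs)
    have s2: "vwalk_arcs (a @ u # c) = vwalk_arcs (a @ [u]) @ vwalk_arcs (u # c)"
      by (rule vwalk_arcs_append_single)
    have "even (arcs_in F (u # b @ [u]))"
      by (rule IH[rule_format]) (use walk s1 a xs in auto)
    moreover have "even (arcs_in F (a @ u # c))"
    proof (rule IH[rule_format])
      show "hd (a @ u # c) = last (a @ u # c)" using closed by (simp add: xs a)
    qed (use walk s1 s2 a xs in auto)
    ultimately show ?thesis unfolding s1 s2 by (auto simp del: vwalk_arcs_Cons)
  next
    case dist: True
    \<comment> \<open>Lengths count the closing vertex, so a list of length 4 is a triangle, and
      chordality applies from length 5, that is, from four arcs on.\<close>
    consider "length xs = 1" | "length xs = 2" | "length xs = 3" | "length xs = 4" | "length xs \<ge> 5"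
      using ne by (cases "length xs") force+
    then show ?thesis
    proof cases
      case 1
      then show ?thesis by (auto simp: length_Suc_conv)
    next
      case 2
      then show ?thesis using irr closed walk
        by (auto simp: length_Suc_conv numeral_eq_Suc irrefl_def)
    next
      case 3
      then obtain u v where "xs = [u, v, u]" using closed
        by (auto simp: length_Suc_conv numeral_eq_Suc)
      then show ?thesis using symF by (auto dest: symD)
    next
      case 4
      then obtain u v w where "xs = [u, v, w, u]" using closed
        by (auto simp: length_Suc_conv numeral_eq_Suc)
      then show ?thesis using F walk unfolding even_on_triangles_def by auto
    next
      case 5
      have "pre_digraph.cycle (with_proj G) (vwalk_arcs xs)"
        by (rule cycle_vwalk_arcs) (use walk closed dist 5 in \<open>auto intro: pair_wf_digraph_axioms\<close>)
      moreover have "length (vwalk_arcs xs) \<ge> 4" using 5 by (simp add: length_vwalk_arcs)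
      ultimately have "\<exists>u\<in>set (butlast xs). \<exists>v\<in>set (butlast xs).
          (u, v) \<in> ?E \<and> (u, v) \<notin> set (vwalk_arcs xs) \<and> (v, u) \<notin> set (vwalk_arcs xs)"
        using ch by (simp add: chordal_def flip: fst_set_vwalk_arcs)
      then obtain u v where uv: "u \<in> set (butlast xs)" "v \<in> set (butlast xs)" "(u, v) \<in> ?E"
        and nuv: "(u, v) \<notin> set (vwalk_arcs xs)" "(v, u) \<notin> set (vwalk_arcs xs)" by blast
      have "u \<noteq> v" using uv irr by (auto simp: irrefl_def)
      \<comment> \<open>The ends of the chord are renamed \<open>s\<close>, \<open>t\<close> in the
        order in which the walk meets them.\<close>
      have "\<exists>s t a b c. butlast xs = a @ s # b @ t # c \<and> (s = u \<and> t = v \<or> s = v \<and> t = u)"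
      proof -
        obtain a d where d: "butlast xs = a @ u # d" using uv by (auto simp: in_set_conv_decomp)
        then consider "v \<in> set a" | "v \<in> set d" using uv \<open>u \<noteq> v\<close> by auto
        then show ?thesis
        proof cases
          case 1
          then obtain a1 a2 where "a = a1 @ v # a2" by (auto simp: in_set_conv_decomp)
          with d show ?thesis
            by (intro exI[of _ v] exI[of _ u] exI[of _ a1] exI[of _ a2] exI[of _ d]) simp
        next
          case 2
          then obtain a1 a2 where "d = a1 @ v # a2" by (auto simp: in_set_conv_decomp)
          with d show ?thesis
            by (intro exI[of _ u] exI[of _ v] exI[of _ a] exI[of _ a1] exI[of _ a2]) simp
        qed
      qed
      then obtain s t a b c0 where bl: "butlast xs = a @ s # b @ t # c0"
        and st: "s = u \<and> t = v \<or> s = v \<and> t = u" by blast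
      define c where "c = c0 @ [last xs]"
      have xs: "xs = a @ s # b @ t # c"
        using append_butlast_last_id[OF ne] by (simp add: bl c_def)
      have stE: "(s, t) \<in> ?E" "(t, s) \<in> ?E" using st uv symE by (auto dest: symD)
      have nst: "(s, t) \<notin> set (vwalk_arcs xs)" "(t, s) \<notin> set (vwalk_arcs xs)"
        using st nuv by auto
      have s1: "vwalk_arcs xs = vwalk_arcs (a @ [s]) @ vwalk_arcs (s # b @ [t]) @ vwalk_arcs (t # c)"
        using vwalk_arcs_append_single[of a s "b @ t # c"]
          vwalk_arcs_append_single[of "s # b" t c] by (simp add: xs)
      have s2: "vwalk_arcs (a @ s # t # c) = vwalk_arcs (a @ [s]) @ (s, t) # vwalk_arcs (t # c)"
        using vwalk_arcs_append_single[of a s "t # c"] by simp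
      have s3: "vwalk_arcs (s # b @ [t, s]) = vwalk_arcs (s # b @ [t]) @ [(t, s)]"
        using vwalk_arcs_append_single[of "s # b" t "[s]"] by simp
      have "c \<noteq> []" by (simp add: c_def)
      \<comment> \<open>Otherwise \<open>(s, t)\<close> would be an arc of the walk. Hence the
        shortcut that skips \<open>b\<close> is strictly shorter.\<close>
      have "b \<noteq> []" using nst(1) s1 by auto
      \<comment> \<open>Otherwise the walk starts at \<open>s\<close> and closes by the arc
        \<open>(t, s)\<close>, which is excluded. Hence the closed walk through \<open>b\<close> and
        the chord is strictly shorter too.\<close>
      have ac: "length a + length c > 1"
      proof (rule ccontr)
        assume "\<not> ?thesis"
        then have "a = []" "c0 = []" by (auto simp: c_def)
        moreover from this have "last xs = s" using closed xs by (metis append_Nil list.sel(1))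
        ultimately show False using s1 nst(2) by (simp add: c_def)
      qed
      have "even (arcs_in F (s # b @ [t, s]))"
      proof (rule IH[rule_format])
        show "length (s # b @ [t, s]) < length xs" using ac by (simp add: xs)
        show "set (vwalk_arcs (s # b @ [t, s])) \<subseteq> ?E" using walk stE unfolding s1 s3 by auto
      qed auto
      moreover have "even (arcs_in F (a @ s # t # c))"
      proof (rule IH[rule_format])
        show "length (a @ s # t # c) < length xs" using \<open>b \<noteq> []\<close> by (simp add: xs)
        show "hd (a @ s # t # c) = last (a @ s # t # c)"
          using closed \<open>c \<noteq> []\<close> by (cases a) (auto simp: xs)
        show "set (vwalk_arcs (a @ s # t # c)) \<subseteq> ?E" using walk stE unfolding s1 s2 by auto
      qed auto
      moreover have "(s, t) \<in> F \<longleftrightarrow> (t, s) \<in> F" using symF by (auto dest: symD)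
      ultimately show ?thesis unfolding s1 s2 s3 by (auto split: if_splits)
    qed
  qed
qed

text \<open>A walk from \<open>u\<close> to \<open>v\<close> avoiding \<open>F\<close>, closed by
  the arc \<open>(v, u)\<close>, would be a closed walk with exactly one arc in
  \<open>F\<close>.\<close>

lemma even_on_triangles_separates:
  assumes "chordal G" "even_on_triangles (parcs G) F" "(u, v) \<in> F"
  shows "(u, v) \<notin> (parcs G - F)\<^sup>*"
proof
  assume "(u, v) \<in> (parcs G - F)\<^sup>*"
  then obtain xs where xs: "xs \<noteq> []" "hd xs = u" "last xs = v" "set (vwalk_arcs xs) \<subseteq> parcs G - F"
    using rtrancl_imp_vwalk_arcs by meson
  have vu: "(v, u) \<in> F" "(v, u) \<in> parcs G"
    using assms(2,3) by (auto simp: even_on_triangles_def dest: symD)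
  have "even (arcs_in F (v # xs))"
    by (rule closed_walk_chord_parity[OF assms(1,2)]) (use xs vu in auto)
  moreover have "filter (\<lambda>e. e \<in> F) (vwalk_arcs xs) = []"
    using xs(4) by (auto simp: filter_empty_conv)
  ultimately show False using xs vu by simp
qed

section \<open>Edges of a subpath by index\<close>

text \<open>Both arcs of every edge of the subpath from index \<open>a\<close> to index
  \<open>b\<close>. Indexing into the whole path makes subpaths comparable as intervals.\<close>

definition path_edges :: "'a list \<Rightarrow> nat \<Rightarrow> nat \<Rightarrow> 'a rel" where
  "path_edges p a b = {(u, v). \<exists>k. a \<le> k \<and> k < b \<and> {u, v} = {p ! k, p ! Suc k}}"

lemma sym_path_edges: "sym (path_edges p a b)"
  by (auto simp: path_edges_def sym_def insert_commute)

lemma path_edges_mono: "a \<le> a' \<Longrightarrow> b' \<le> b \<Longrightarrow> path_edges p a' b' \<subseteq> path_edges p a b"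
proof (rule subrelI)
  fix u v assume le: "a \<le> a'" "b' \<le> b" and "(u, v) \<in> path_edges p a' b'"
  then obtain k where "a' \<le> k" "k < b'" "{u, v} = {p ! k, p ! Suc k}" by (auto simp: path_edges_def)
  with le show "(u, v) \<in> path_edges p a b"
    unfolding path_edges_def by (auto intro!: exI[of _ k])
qed

lemma path_edgeI: "a \<le> k \<Longrightarrow> k < b \<Longrightarrow> (p ! k, p ! Suc k) \<in> path_edges p a b"
  by (auto simp: path_edges_def)

lemma length_subpath: "j < length p \<Longrightarrow> length (subpath p i j) = Suc j - i"
  by (simp add: subpath_def)

lemma nth_subpath: "j < length p \<Longrightarrow> k < Suc j - i \<Longrightarrow> subpath p i j ! k = p ! (i + k)"
  by (simp add: subpath_def)

lemma subpath_whole: "p \<noteq> [] \<Longrightarrow> subpath p 0 (length p - 1) = p"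
  by (cases p) (simp_all add: subpath_def)

lemma subpath_subpath:
  assumes "x \<le> y" "y < length (subpath p i j)" "j < length p" "i \<le> j"
  shows "subpath (subpath p i j) x y = subpath p (i + x) (i + y)"
  using assms by (intro nth_equalityI) (auto simp: length_subpath nth_subpath add.assoc)

lemma path_edges_conv:
  assumes "j < length p"
  shows "set (vwalk_arcs (subpath p i j)) \<union> (set (vwalk_arcs (subpath p i j)))\<inverse> = path_edges p i j"
proof -
  have "set (vwalk_arcs (subpath p i j)) = {(p ! k, p ! Suc k) |k. i \<le> k \<and> k < j}"
  proof (intro set_eqI iffI)
    fix e assume "e \<in> set (vwalk_arcs (subpath p i j))"
    then obtain k where k: "Suc k < Suc j - i" "e = (subpath p i j ! k, subpath p i j ! Suc k)"
      by (auto simp: set_vwalk_arcs_conv_nth length_subpath assms)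
    then show "e \<in> {(p ! k, p ! Suc k) |k. i \<le> k \<and> k < j}"
      by (intro CollectI exI[of _ "i + k"]) (auto simp: nth_subpath assms)
  next
    fix e assume "e \<in> {(p ! k, p ! Suc k) |k. i \<le> k \<and> k < j}"
    then obtain k where "i \<le> k" "k < j" "e = (p ! k, p ! Suc k)" by blast
    then show "e \<in> set (vwalk_arcs (subpath p i j))"
      by (auto simp: set_vwalk_arcs_conv_nth length_subpath assms nth_subpath
          intro!: exI[of _ "k - i"])
  qed
  then show ?thesis by (auto simp: path_edges_def doubleton_eq_iff)
qed

lemma remove_subpath_edges:
  "j < length p \<Longrightarrow>
    remove_path_edges G (subpath p i j) = G\<lparr>parcs := parcs G - path_edges p i j\<rparr>"
  by (simp add: remove_path_edges_def path_edges_conv)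

lemma path_edges_nth:
  assumes "distinct p" "b < length p" "m < length p" "m' < length p"
    "(p ! m, p ! m') \<in> path_edges p a b"
  shows "a \<le> m \<and> a \<le> m' \<and> m \<le> b \<and> m' \<le> b \<and> (m' = Suc m \<or> m = Suc m')"
  using assms by (auto simp: path_edges_def doubleton_eq_iff nth_eq_iff_index_eq)

lemma path_edges_obtain:
  assumes "(u, v) \<in> path_edges p a b" "b < length p"
  obtains m m' where "u = p ! m" "v = p ! m'" "m < length p" "m' < length p"
    "a \<le> m" "m \<le> b" "a \<le> m'" "m' \<le> b" "m' = Suc m \<or> m = Suc m'"
proof -
  from assms obtain k where k: "a \<le> k" "k < b" "{u, v} = {p ! k, p ! Suc k}"
    by (auto simp: path_edges_def)
  then consider "u = p ! k" "v = p ! Suc k" | "u = p ! Suc k" "v = p ! k"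
    by (auto simp: doubleton_eq_iff)
  then show ?thesis
  proof cases
    case 1
    show ?thesis by (rule that[OF 1]) (use k assms in auto)
  next
    case 2
    show ?thesis by (rule that[OF 2]) (use k assms in auto)
  qed
qed

section \<open>Restricting a cut to a subpath\<close>

text \<open>Evenness can break only at a triangle with one edge of \<open>D\<close> inside the
  interval and one outside. These are consecutive path edges meeting at index \<open>a\<close> or
  \<open>b\<close>, and the third side is the edge that \<open>cut\<close> forbids.\<close>

lemma even_on_triangles_restrict:
  assumes p: "distinct p" "t < length p" and "s \<le> a" "a \<le> b" "b \<le> t" and irr: "irrefl E" and symE: "sym E"
    and D: "even_on_triangles E D" "D \<subseteq> path_edges p s t"
    and cut: "\<And>m. m \<in> {a, b} \<Longrightarrow> s < m \<Longrightarrow> m < t \<Longrightarrow> (p ! (m - 1), p ! m) \<in> D \<Longrightarrow>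
      (p ! m, p ! Suc m) \<in> D \<Longrightarrow> (p ! (m - 1), p ! Suc m) \<notin> E"
  shows "even_on_triangles E (D \<inter> path_edges p a b)"
proof -
  let ?D = "D \<inter> path_edges p a b"
  have D_sym: "sym D" and DE: "D \<subseteq> E" using D(1) by (auto simp: even_on_triangles_def)
  have D'_sym: "sym ?D" using D_sym sym_path_edges by (rule sym_Int)
  \<comment> \<open>Two edges of \<open>D\<close> in one triangle are kept or dropped
    together.\<close>
  have key: "(y, z) \<in> ?D"
    if xy: "(x, y) \<in> ?D" and yz: "(y, z) \<in> D" and xz: "(x, z) \<in> E" "(z, x) \<in> E" for x y z
  proof -
    have b: "b < length p" using assms by simp
    obtain i m where im: "x = p ! i" "y = p ! m" "i < length p" "m < length p"
      "a \<le> i" "i \<le> b" "a \<le> m" "m \<le> b" "m = Suc i \<or> i = Suc m"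
      using xy b by (elim IntE path_edges_obtain) auto
    obtain m' k where mk: "y = p ! m'" "z = p ! k" "m' < length p" "k < length p"
      "s \<le> m'" "m' \<le> t" "s \<le> k" "k \<le> t" "k = Suc m' \<or> m' = Suc k"
      using path_edges_obtain[of y z p s t] yz D(2) p(2) by blast
    have "m' = m" using im mk p(1) by (simp add: nth_eq_iff_index_eq)
    have "x \<noteq> z" using irr xz by (auto simp: irrefl_def)
    then have "i \<noteq> k" using im mk by auto
    \<comment> \<open>If \<open>z\<close> lay outside the interval, \<open>y\<close> would sit at
      its end \<open>a\<close> or \<open>b\<close> with \<open>x\<close> and \<open>z\<close> as its
      two path neighbours, and the side from \<open>x\<close> to \<open>z\<close> would contradict
      \<open>cut\<close>.\<close>
    have "a \<le> k \<and> k \<le> b"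
    proof (rule ccontr)
      assume "\<not> ?thesis"
      then consider "k < a" | "b < k" by linarith
      then have "\<exists>m\<in>{a, b}. s < m \<and> m < t \<and> (p ! (m - 1), p ! m) \<in> D \<and>
          (p ! m, p ! Suc m) \<in> D \<and> (p ! (m - 1), p ! Suc m) \<in> E"
      proof cases
        case 1
        then have "m = Suc k" "m = a" using im(5-9) mk(5-9) \<open>m' = m\<close> by arith+
        moreover from this have "i = Suc m" using im(9) \<open>i \<noteq> k\<close> by arith
        ultimately show ?thesis
          using xy yz xz D_sym im(1,2,6) mk(2,7) assms(3-5) by (intro bexI[of _ m]) (auto dest: symD)
      next
        case 2
        then have "k = Suc m" "m = b" using im(5-9) mk(5-9) \<open>m' = m\<close> by arith+
        moreover from this have "m = Suc i" using im(9) \<open>i \<noteq> k\<close> by arith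
        ultimately show ?thesis
          using xy yz xz D_sym im(1,2,5) mk(2,8) assms(3-5) by (intro bexI[of _ m]) (auto dest: symD)
      qed
      with cut show False by blast
    qed
    then have "(y, z) \<in> path_edges p a b"
      using mk im \<open>m' = m\<close> by (auto simp: path_edges_def insert_commute)
    with yz show ?thesis by simp
  qed
  show ?thesis
    unfolding even_on_triangles_def
  proof (intro conjI allI impI)
    fix u v w assume uvw: "(u, v) \<in> ?D \<and> (v, w) \<in> E \<and> (w, u) \<in> E"
    then have one: "((v, w) \<in> D) \<noteq> ((w, u) \<in> D)"
      using D(1) by (auto simp: even_on_triangles_def)
    show "((v, w) \<in> ?D) \<noteq> ((w, u) \<in> ?D)"
    proof (cases "(v, w) \<in> D")
      case True
      then have "(w, u) \<notin> ?D" using one by blast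
      moreover have "(v, w) \<in> ?D" by (rule key[of u v w]) (use True uvw symE in \<open>auto dest: symD\<close>)
      ultimately show ?thesis using one by blast
    next
      case False
      then have "(u, w) \<in> D" using one D_sym by (auto dest: symD)
      then have "(u, w) \<in> ?D"
        by (rule key[of v u w, rotated]) (use uvw symE D'_sym in \<open>auto dest: symD\<close>)
      then show ?thesis using False D'_sym by (auto dest: symD)
    qed
  qed (use DE D'_sym in auto)
qed

section \<open>Connectivity and components as reachability\<close>

lemma connected_conv_rtrancl:
  assumes "pair_sym_digraph H"
  shows "connected H \<longleftrightarrow>
    pverts H \<noteq> {} \<and> (\<forall>u\<in>pverts H. \<forall>v\<in>pverts H. (u, v) \<in> (parcs H)\<^sup>*)"
proof -
  interpret pair_sym_digraph H by fact
  have sym: "symmetric (with_proj H)" by (rule pair_sym_arcs)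
  show ?thesis
    unfolding connected_def strongly_connected_def
    using reachable_mk_symmetric_eq[OF sym] by (auto simp: mk_symmetric_def reachable_conv)
qed

text \<open>Components are replaced by representatives: distinct components are disjoint, so they
  differ exactly if \<open>a\<close> does not reach \<open>b\<close>. Conversely, the vertices
  reachable from a representative induce its component.\<close>

lemma parity_split_conv_rtrancl:
  assumes "pair_sym_digraph H"
  shows "parity_split H q \<longleftrightarrow>
    (\<exists>a\<in>pverts H. \<exists>b\<in>pverts H. (a, b) \<notin> (parcs H)\<^sup>* \<and>
      (\<forall>k<length q. odd k \<longrightarrow> (a, q ! k) \<in> (parcs H)\<^sup>*) \<and>
      (\<forall>k<length q. even k \<longrightarrow> (b, q ! k) \<in> (parcs H)\<^sup>*))" (is "?L \<longleftrightarrow> ?R")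
proof
  interpret pair_sym_digraph H by fact
  assume ?L
  then obtain Co Ce where C: "Co \<in> sccs" "Ce \<in> sccs" "Co \<noteq> Ce"
    and odd: "\<And>k. k < length q \<Longrightarrow> odd k \<Longrightarrow> q ! k \<in> verts Co"
    and even: "\<And>k. k < length q \<Longrightarrow> even k \<Longrightarrow> q ! k \<in> verts Ce"
    unfolding parity_split_def by blast
  have S: "verts Co \<in> sccs_verts" "verts Ce \<in> sccs_verts"
    using C in_sccs_vertsI_sccs by blast+
  then obtain a b where ab: "a \<in> verts Co" "b \<in> verts Ce"
    by (fastforce simp: sccs_verts_def)
  have reach: "(u, v) \<in> (parcs H)\<^sup>*" "u \<in> pverts H"
    if "u \<in> S" "v \<in> S" "S \<in> sccs_verts" for S u v
    using that by (auto simp: sccs_verts_def reachable_conv)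
  have "verts Co \<inter> verts Ce = {}"
    using S C sccs_verts_disjoint inj_on_verts_sccs by (metis inj_onD)
  then have "b \<notin> verts Co" using ab by blast
  have "(a, b) \<notin> (parcs H)\<^sup>*"
  proof
    assume "(a, b) \<in> (parcs H)\<^sup>*"
    then have "a \<rightarrow>\<^sup>*\<^bsub>with_proj H\<^esub> b" using reach(2)[OF ab(1) ab(1) S(1)]
        reach(2)[OF ab(2) ab(2) S(2)] by (simp add: reachable_conv)
    moreover from this have "b \<rightarrow>\<^sup>*\<^bsub>with_proj H\<^esub> a" by (rule symmetric_reachable')
    ultimately show False
      using S(1) ab(1) \<open>b \<notin> verts Co\<close> by (auto simp: sccs_verts_def)
  qed
  moreover have "a \<in> pverts H" "b \<in> pverts H" using reach(2) ab S by blast+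
  moreover have "\<forall>k<length q. odd k \<longrightarrow> (a, q ! k) \<in> (parcs H)\<^sup>*"
    using reach(1)[OF ab(1) odd S(1)] by simp
  moreover have "\<forall>k<length q. even k \<longrightarrow> (b, q ! k) \<in> (parcs H)\<^sup>*"
    using reach(1)[OF ab(2) even S(2)] by simp
  ultimately show ?R by blast
next
  interpret pair_sym_digraph H by fact
  assume ?R
  then obtain a b where ab: "a \<in> pverts H" "b \<in> pverts H" "(a, b) \<notin> (parcs H)\<^sup>*"
    and odd: "\<And>k. k < length q \<Longrightarrow> odd k \<Longrightarrow> (a, q ! k) \<in> (parcs H)\<^sup>*"
    and even: "\<And>k. k < length q \<Longrightarrow> even k \<Longrightarrow> (b, q ! k) \<in> (parcs H)\<^sup>*"
    by blast
  let ?C = "\<lambda>u. with_proj H \<restriction> {v. u \<rightarrow>\<^sup>*\<^bsub>with_proj H\<^esub> v}"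
  have sccs: "?C a \<in> sccs" "?C b \<in> sccs"
    using ab by (auto intro: induce_reachable_is_in_sccs)
  have v: "v \<in> verts (?C u) \<longleftrightarrow> (u, v) \<in> (parcs H)\<^sup>*" if "u \<in> pverts H" for u v
    using that by (simp add: reachable_conv')
  have "b \<notin> verts (?C a)" "b \<in> verts (?C b)" using ab v by auto
  then have "?C a \<noteq> ?C b" by metis
  then show ?L
    unfolding parity_split_def using sccs odd even v ab by blast
qed

lemma pair_sym_digraph_delete:
  assumes "pair_bidirected_digraph G" "sym F"
  shows "pair_sym_digraph (G\<lparr>parcs := parcs G - F\<rparr>)"
proof -
  interpret pair_bidirected_digraph G by fact
  show ?thesis
  proof
    show "symmetric (with_proj (G\<lparr>parcs := parcs G - F\<rparr>))"
      using pair_sym_arcs assms(2) by (auto simp: symmetric_def sym_def)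
  qed (auto dest: arc_fst_in_verts arc_snd_in_verts)
qed

lemma vwalk_subpath:
  assumes "vwalk p G" "i \<le> j" "j < length p"
  shows "vwalk (subpath p i j) G"
proof -
  have "set (subpath p i j) \<subseteq> set p"
    unfolding subpath_def using set_take_subset set_drop_subset by (metis subset_trans)
  moreover have "set (vwalk_arcs (subpath p i j)) \<subseteq> set (vwalk_arcs p)"
  proof
    fix e assume "e \<in> set (vwalk_arcs (subpath p i j))"
    then obtain k where "Suc k < Suc j - i" "e = (subpath p i j ! k, subpath p i j ! Suc k)"
      by (auto simp: set_vwalk_arcs_conv_nth length_subpath assms)
    then show "e \<in> set (vwalk_arcs p)"
      unfolding set_vwalk_arcs_conv_nth using assms
      by (intro CollectI exI[of _ "i + k"]) (auto simp: nth_subpath)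
  qed
  moreover have "subpath p i j \<noteq> []" using assms by (simp add: subpath_def)
  ultimately show ?thesis using assms(1) unfolding vwalk_def by blast
qed

lemma separating_subpath_conv:
  assumes "pair_bidirected_digraph G" "connected G" "vwalk p G" "i \<le> j" "j < length p"
  shows "separating_path G (subpath p i j) \<longleftrightarrow>
    (\<exists>u\<in>pverts G. \<exists>v\<in>pverts G. (u, v) \<notin> (parcs G - path_edges p i j)\<^sup>*)"
proof -
  have "pverts G \<noteq> {}"
    using assms(3) by (auto simp: vwalk_def)
  then show ?thesis
    using vwalk_subpath[OF assms(3-5)] pair_sym_digraph_delete[OF assms(1) sym_path_edges]
    by (simp add: separating_path_def remove_subpath_edges assms connected_conv_rtrancl)
qed

text \<open>Turns minimality of a subpath into a statement about intervals of indices of the ambient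
  path.\<close>

lemma path_contains_subpath_iff:
  assumes "i \<le> j" "j < length p"
  shows "path_contains (subpath p i j) q \<longleftrightarrow>
    (\<exists>x y. i \<le> x \<and> x \<le> y \<and> y \<le> j \<and> q = subpath p x y)" (is "?L \<longleftrightarrow> ?R")
proof
  assume ?L
  then obtain x y where "x \<le> y" "y < length (subpath p i j)" "q = subpath (subpath p i j) x y"
    by (auto simp: path_contains_def)
  then show ?R
    using assms by (intro exI[of _ "i + x"] exI[of _ "i + y"]) (auto simp: subpath_subpath length_subpath)
next
  assume ?R
  then obtain x y where "i \<le> x" "x \<le> y" "y \<le> j" "q = subpath p x y" by blast
  then show ?L
    unfolding path_contains_def using assms
    by (intro exI[of _ "x - i"] exI[of _ "y - i"]) (auto simp: subpath_subpath length_subpath)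
qed

lemma path_contains_subpathI:
  assumes "x \<le> i" "i \<le> j" "j \<le> y" "y < length p"
  shows "path_contains (subpath p x y) (subpath p i j)"
proof -
  have "x \<le> y" using assms by linarith
  then show ?thesis using assms path_contains_subpath_iff[of x y p "subpath p i j"] by blast
qed

section \<open>From separator paths to the parity split\<close>

text \<open>Minimality forces an edge between any two vertices two steps apart on the subpath. Such
  an edge is not on \<open>p\<close>, so it survives the removal of all of \<open>p\<close>, not
  only of the subpath.\<close>

lemma separator_imp_parity_split:
  assumes ch: "chordal G" and con: "connected G" and p: "vpath p G" and ij: "i < j" "j < length p"
    and sep: "separator_path G (subpath p i j)"
  shows "parity_split (remove_path_edges G p) (subpath p i j)"
proof -
  let ?E = "parcs G"
  let ?Q = "path_edges p 0 (length p - 1)"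
  let ?H = "?E - path_edges p i j"
  have bid: "pair_bidirected_digraph G" by (rule chordal_pair_bidirected[OF ch])
  have symE: "sym ?E" and irr: "irrefl ?E" and wf: "?E \<subseteq> pverts G \<times> pverts G"
    using pair_bidirected_facts[OF bid] by auto
  have walk: "vwalk p G" and dist: "distinct p" using p by auto
  have conE: "(u, v) \<in> ?E\<^sup>*" if "u \<in> pverts G" "v \<in> pverts G" for u v
    using con that connected_conv_rtrancl[of G] bid
    by (auto simp: pair_bidirected_digraph_def)
  have sep_conv: "separating_path G (subpath p x y) \<longleftrightarrow>
      (\<exists>u\<in>pverts G. \<exists>v\<in>pverts G. (u, v) \<notin> (?E - path_edges p x y)\<^sup>*)"
    if "x \<le> y" "y < length p" for x y
    by (rule separating_subpath_conv[OF bid con walk that])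
  have symH: "sym ?H" using symE sym_path_edges[of p i j] by (auto simp: sym_def)
  then have symH': "sym (?H\<^sup>*)" by (rule sym_rtrancl)
  obtain u v where uv: "u \<in> pverts G" "v \<in> pverts G" "(u, v) \<notin> ?H\<^sup>*"
    using sep sep_conv[of i j] ij by (auto simp: separator_path_def)
  \<comment> \<open>\<open>A\<close> is the component of \<open>u\<close> after removing the
    subpath, and \<open>D\<close> below is the cut between \<open>A\<close> and its complement. A
    triangle crosses a cut zero or two times.\<close>
  define A where "A = {x. (u, x) \<in> ?H\<^sup>*}"
  have AH: "x \<in> A \<longleftrightarrow> y \<in> A" if "(x, y) \<in> ?H\<^sup>*" for x y
    using that symH' unfolding A_def by (auto dest: symD intro: rtrancl_trans)
  define D where "D = {(x, y) \<in> ?E. (x \<in> A) \<noteq> (y \<in> A)}"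
  have D_sym: "sym D" using symE by (auto simp: D_def sym_def)
  have evenD: "even_on_triangles ?E D"
    using D_sym by (auto simp: even_on_triangles_def D_def)
  have DP: "D \<subseteq> path_edges p i j"
    using AH by (auto simp: D_def)
  \<comment> \<open>Without crossing edges, \<open>A\<close> would contain all that \<open>u\<close>
    reaches in the connected graph, including \<open>v\<close>.\<close>
  have "D \<noteq> {}"
  proof
    assume "D = {}"
    have "x \<in> A" if "(u, x) \<in> ?E\<^sup>*" for x
      using that
    proof induction
      case (step y z)
      then show ?case using \<open>D = {}\<close> by (auto simp: D_def)
    qed (simp add: A_def)
    then show False using conE uv by (auto simp: A_def)
  qed
  have min: "x = i \<and> y = j"
    if "i \<le> x" "x \<le> y" "y \<le> j" "separating_path G (subpath p x y)" for x y
  proof -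
    have "subpath p x y = subpath p i j"
      using sep that ij path_contains_subpath_iff[of i j p] unfolding separator_path_def by auto
    then have "Suc y - x = Suc j - i" using that ij by (metis length_subpath order_le_less_trans)
    then show ?thesis using that ij by linarith
  qed
  \<comment> \<open>A nonempty even part of \<open>D\<close> on a proper subpath separates the ends
    of its edges, which would make that subpath separating.\<close>
  have empty: "D \<inter> path_edges p x y = {}"
    if xy: "i \<le> x" "x \<le> y" "y \<le> j" "x \<noteq> i \<or> y \<noteq> j"
      and ev: "even_on_triangles ?E (D \<inter> path_edges p x y)" for x y
  proof (rule ccontr)
    assume "\<not> ?thesis"
    then obtain s t where st: "(s, t) \<in> D \<inter> path_edges p x y" by auto
    have "(s, t) \<notin> (?E - (D \<inter> path_edges p x y))\<^sup>*"
      by (rule even_on_triangles_separates[OF ch ev st])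
    moreover have "(?E - path_edges p x y)\<^sup>* \<subseteq> (?E - (D \<inter> path_edges p x y))\<^sup>*"
      by (rule rtrancl_mono) auto
    ultimately have "separating_path G (subpath p x y)"
      using sep_conv[of x y] xy ij st wf by (auto simp: D_def)
    with min xy show False by blast
  qed
  \<comment> \<open>If this fails at \<open>m\<close>, then \<open>D\<close> may be restricted to
    either side of \<open>m\<close>. Both parts lie on proper subpaths, so both are empty, although
    together they cover \<open>D\<close>.\<close>
  have inner: "(p ! (m - 1), p ! m) \<in> D \<and> (p ! m, p ! Suc m) \<in> D \<and> (p ! (m - 1), p ! Suc m) \<in> ?E"
    if m: "i < m" "m < j" for m
  proof (rule ccontr)
    assume n: "\<not> ?thesis"
    have "even_on_triangles ?E (D \<inter> path_edges p i m)" "even_on_triangles ?E (D \<inter> path_edges p m j)"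
      by (rule even_on_triangles_restrict[OF dist ij(2) _ _ _ irr symE evenD DP]; use m n in auto)+
    then have "D \<inter> path_edges p i m = {}" "D \<inter> path_edges p m j = {}"
      using empty m by auto
    moreover have "path_edges p i j \<subseteq> path_edges p i m \<union> path_edges p m j"
    proof (rule subrelI)
      fix x y assume "(x, y) \<in> path_edges p i j"
      then obtain k where k: "i \<le> k" "k < j" "{x, y} = {p ! k, p ! Suc k}"
        by (auto simp: path_edges_def)
      then show "(x, y) \<in> path_edges p i m \<union> path_edges p m j"
        unfolding path_edges_def using not_le_imp_less[of m k] by blast
    qed
    ultimately show False using DP \<open>D \<noteq> {}\<close> by blast
  qed
  \<comment> \<open>A subpath of a single edge has no inner vertex; there, nonemptiness of
    \<open>D\<close> puts the edge into \<open>D\<close>.\<close>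
  have first: "(p ! i, p ! Suc i) \<in> D"
  proof (cases "j = Suc i")
    case True
    then have "D \<subseteq> {(p ! i, p ! Suc i), (p ! Suc i, p ! i)}"
      using DP by (auto simp: path_edges_def doubleton_eq_iff less_Suc_eq_le)
    with \<open>D \<noteq> {}\<close> D_sym show ?thesis by (auto dest: symD)
  next
    case False
    then show ?thesis using inner[of "Suc i"] ij by auto
  qed
  have step: "(p ! k, p ! Suc (Suc k)) \<in> (?E - ?Q)\<^sup>*" if "i \<le> k" "Suc (Suc k) \<le> j" for k
  proof -
    have "(p ! k, p ! Suc (Suc k)) \<in> ?E" using inner[of "Suc k"] that by auto
    moreover have n: "length p - 1 < length p" using ij by simp
    have "(p ! k, p ! Suc (Suc k)) \<notin> ?Q"
      using path_edges_nth[OF dist n, of k "Suc (Suc k)" 0] that ij by auto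
    ultimately show ?thesis by auto
  qed
  have steps: "(p ! k, p ! (k + 2 * l)) \<in> (?E - ?Q)\<^sup>*" if "i \<le> k" "k + 2 * l \<le> j" for k l
    using that
  proof (induction l)
    case (Suc l)
    then show ?case using step[of "k + 2 * l"] by (auto intro: rtrancl_trans)
  qed simp
  have vert: "p ! k \<in> pverts G" if "k < length p" for k
    using walk that by (auto simp: vwalk_def)
  \<comment> \<open>The first edge crosses the cut, so its ends lie in different components and
    represent the odd and the even class. Parity is counted from \<open>i\<close>.\<close>
  have "(p ! Suc i, p ! i) \<notin> (?E - ?Q)\<^sup>*"
  proof
    assume "(p ! Suc i, p ! i) \<in> (?E - ?Q)\<^sup>*"
    moreover have "path_edges p i j \<subseteq> ?Q" using ij by (intro path_edges_mono) auto
    then have "(?E - ?Q)\<^sup>* \<subseteq> ?H\<^sup>*" by (intro rtrancl_mono) auto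
    ultimately show False using AH first by (auto simp: D_def)
  qed
  moreover have "(p ! Suc i, subpath p i j ! k) \<in> (?E - ?Q)\<^sup>*"
    if "k < length (subpath p i j)" "odd k" for k
    using that ij steps[of "Suc i"]
    by (auto simp: length_subpath nth_subpath elim!: oddE)
  moreover have "(p ! i, subpath p i j ! k) \<in> (?E - ?Q)\<^sup>*"
    if "k < length (subpath p i j)" "even k" for k
    using that ij steps[of i]
    by (auto simp: length_subpath nth_subpath elim!: evenE)
  moreover have "p \<noteq> []" using ij by auto
  then have "remove_path_edges G p = G\<lparr>parcs := ?E - ?Q\<rparr>"
    using remove_subpath_edges[of "length p - 1" p G 0] subpath_whole[of p] by simp
  ultimately show ?thesis
    using vert[of i] vert[of "Suc i"] ij
      parity_split_conv_rtrancl[OF pair_sym_digraph_delete[OF bid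
        sym_path_edges[of p 0 "length p - 1"]], of "subpath p i j"]
    by auto
qed

section \<open>From maximal parity splits to separator paths\<close>

text \<open>Maximality is applied to the extensions of the subpath by one vertex at either end; it
  keeps the adjacent path edges out of the cut between the two components, so that the cut can be
  restricted.\<close>

lemma maximal_parity_split_imp_separator:
  assumes ch: "chordal G" and con: "connected G" and p: "vpath p G" and ij: "i < j" "j < length p"
    and split: "parity_split (remove_path_edges G p) (subpath p i j)"
    and max: "\<And>x y. x < y \<Longrightarrow> y < length p \<Longrightarrow> subpath p x y \<noteq> subpath p i j \<Longrightarrow>
      path_contains (subpath p x y) (subpath p i j) \<Longrightarrow>
      \<not> parity_split (remove_path_edges G p) (subpath p x y)"
  shows "separator_path G (subpath p i j)"
proof -
  let ?E = "parcs G"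
  let ?Q = "path_edges p 0 (length p - 1)"
  let ?R = "(?E - ?Q)\<^sup>*"
  have bid: "pair_bidirected_digraph G" by (rule chordal_pair_bidirected[OF ch])
  have symE: "sym ?E" and irr: "irrefl ?E" and wf: "?E \<subseteq> pverts G \<times> pverts G"
    using pair_bidirected_facts[OF bid] by auto
  have walk: "vwalk p G" and dist: "distinct p" using p by auto
  have conE: "(u, v) \<in> ?E\<^sup>*" if "u \<in> pverts G" "v \<in> pverts G" for u v
    using con that connected_conv_rtrancl[of G] bid
    by (auto simp: pair_bidirected_digraph_def)
  have sep_conv: "separating_path G (subpath p x y) \<longleftrightarrow>
      (\<exists>u\<in>pverts G. \<exists>v\<in>pverts G. (u, v) \<notin> (?E - path_edges p x y)\<^sup>*)"
    if "x \<le> y" "y < length p" for x y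
    by (rule separating_subpath_conv[OF bid con walk that])
  have "p \<noteq> []" using ij by auto
  then have rem: "remove_path_edges G p = G\<lparr>parcs := ?E - ?Q\<rparr>"
    using remove_subpath_edges[of "length p - 1" p G 0] subpath_whole[of p] by simp
  have split_conv: "parity_split (remove_path_edges G p) q \<longleftrightarrow>
      (\<exists>a\<in>pverts G. \<exists>b\<in>pverts G. (a, b) \<notin> ?R \<and> (\<forall>k<length q. odd k \<longrightarrow> (a, q ! k) \<in> ?R) \<and>
        (\<forall>k<length q. even k \<longrightarrow> (b, q ! k) \<in> ?R))" for q
    using parity_split_conv_rtrancl[OF pair_sym_digraph_delete[OF bid
        sym_path_edges[of p 0 "length p - 1"]], of q]
    unfolding rem by simp
  have symR: "sym ?R" using symE sym_path_edges[of p 0 "length p - 1"]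
    by (intro sym_rtrancl) (auto simp: sym_def)
  obtain a b where ab: "a \<in> pverts G" "b \<in> pverts G" "(a, b) \<notin> ?R"
    and odd: "\<And>k. k < length (subpath p i j) \<Longrightarrow> odd k \<Longrightarrow> (a, subpath p i j ! k) \<in> ?R"
    and even: "\<And>k. k < length (subpath p i j) \<Longrightarrow> even k \<Longrightarrow> (b, subpath p i j ! k) \<in> ?R"
    using split unfolding split_conv by blast
  define Co Ce where "Co = {x. (a, x) \<in> ?R}" and "Ce = {x. (b, x) \<in> ?R}"
  have disj: "Co \<inter> Ce = {}"
    using ab(3) symR unfolding Co_def Ce_def by (auto dest: symD intro: rtrancl_trans)
  have closed: "x \<in> Co \<longleftrightarrow> y \<in> Co" "x \<in> Ce \<longleftrightarrow> y \<in> Ce" if "(x, y) \<in> ?E" "(x, y) \<notin> ?Q" for x y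
  proof -
    have "(x, y) \<in> ?R" "(y, x) \<in> ?R" using that symR by (auto dest: symD)
    then show "x \<in> Co \<longleftrightarrow> y \<in> Co" "x \<in> Ce \<longleftrightarrow> y \<in> Ce"
      unfolding Co_def Ce_def by (auto intro: rtrancl_trans)
  qed
  have sideo: "p ! k \<in> Co" if "i \<le> k" "k \<le> j" "odd (k - i)" for k
    using odd[of "k - i"] that ij by (simp add: Co_def length_subpath nth_subpath)
  have sidee: "p ! k \<in> Ce" if "i \<le> k" "k \<le> j" "even (k - i)" for k
    using even[of "k - i"] that ij by (simp add: Ce_def length_subpath nth_subpath)
  define D where "D = {(x, y) \<in> ?E. x \<in> Co \<and> y \<in> Ce \<or> x \<in> Ce \<and> y \<in> Co}"
  have D_sym: "sym D" using symE by (auto simp: D_def sym_def)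
  have DQ: "D \<subseteq> ?Q" using closed disj by (auto simp: D_def)
  \<comment> \<open>Edges of \<open>p\<close> join consecutive indices, and three indices cannot be
    pairwise consecutive.\<close>
  have notri: False if tri: "(u, v) \<in> ?Q" "(v, w) \<in> ?Q" "(w, u) \<in> ?Q" for u v w
  proof -
    have n: "length p - 1 < length p" using ij by simp
    obtain k l where kl: "u = p ! k" "v = p ! l" "k < length p" "l < length p" "l = Suc k \<or> k = Suc l"
      using path_edges_obtain[OF tri(1) n] by blast
    obtain m where m: "w = p ! m" "m < length p"
      using path_edges_obtain[OF tri(3) n] by blast
    show False
      using path_edges_nth[OF dist n, of l m 0] path_edges_nth[OF dist n, of m k 0] tri kl m by auto
  qed
  have evenD: "even_on_triangles ?E D"
    unfolding even_on_triangles_def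
  proof (intro conjI allI impI)
    fix u v w assume uvw: "(u, v) \<in> D \<and> (v, w) \<in> ?E \<and> (w, u) \<in> ?E"
    \<comment> \<open>Otherwise both edges at \<open>w\<close> leave a component and so lie on
      \<open>p\<close>, as does the edge from \<open>u\<close> to \<open>v\<close>: a triangle on a
      path.\<close>
    have "w \<in> Co \<union> Ce"
    proof (rule ccontr)
      assume "w \<notin> Co \<union> Ce"
      then have "(v, w) \<in> ?Q" "(w, u) \<in> ?Q" "(u, v) \<in> ?Q"
        using uvw closed[of v w] closed[of w u] DQ by (auto simp: D_def)
      with notri show False by blast
    qed
    then show "((v, w) \<in> D) \<noteq> ((w, u) \<in> D)" using uvw disj by (auto simp: D_def)
  qed (use D_sym in \<open>auto simp: D_def\<close>)
  have pE: "(p ! k, p ! Suc k) \<in> ?E" if "Suc k < length p" for k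
    using walk that by (auto simp: vwalk_def set_vwalk_arcs_conv_nth)
  have edge: "(p ! k, p ! Suc k) \<in> D" if "i \<le> k" "k < j" for k
    using that ij pE[of k] sideo[of k] sidee[of k] sideo[of "Suc k"] sidee[of "Suc k"]
    by (auto simp: D_def Suc_diff_le)
  \<comment> \<open>If this edge were in \<open>D\<close>, the subpath extended to the left would
    split as well. Indices shift by one there, so \<open>a\<close> and \<open>b\<close> exchange
    their roles.\<close>
  have left: "(p ! (i - 1), p ! i) \<notin> D" if "0 < i"
  proof
    assume "(p ! (i - 1), p ! i) \<in> D"
    then have o: "p ! (i - 1) \<in> Co" using sidee[of i] disj ij by (auto simp: D_def)
    have "parity_split (remove_path_edges G p) (subpath p (i - 1) j)"
      unfolding split_conv
    proof (intro bexI conjI allI impI)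
      show "(b, a) \<notin> ?R" using ab(3) symR by (auto dest: symD)
      fix k assume k: "k < length (subpath p (i - 1) j)"
      then have k': "k < Suc j - (i - 1)" using ij by (simp add: length_subpath)
      show "(b, subpath p (i - 1) j ! k) \<in> ?R" if "odd k"
        using sidee[of "i - 1 + k"] that k' ij \<open>0 < i\<close>
        by (auto simp: nth_subpath Ce_def elim!: oddE)
      show "(a, subpath p (i - 1) j ! k) \<in> ?R" if "even k"
      proof (cases k)
        case 0
        then show ?thesis using o ij k' by (simp add: nth_subpath Co_def)
      next
        case (Suc k0)
        then show ?thesis using sideo[of "i - 1 + k"] that k' ij \<open>0 < i\<close>
          by (auto simp: nth_subpath Co_def)
      qed
    qed (use ab in auto)
    moreover have "subpath p (i - 1) j \<noteq> subpath p i j"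
      using ij that length_subpath[of j p i] length_subpath[of j p "i - 1"] by (intro notI) simp
    moreover have "path_contains (subpath p (i - 1) j) (subpath p i j)"
      using ij by (intro path_contains_subpathI) auto
    ultimately show False using max[of "i - 1" j] ij by linarith
  qed
  \<comment> \<open>Extending to the right keeps the indices; the new vertex lies in the component
    opposite to that of \<open>p ! j\<close>, and \<open>o\<close> and \<open>e\<close> treat the
    two parities of its index.\<close>
  have right: "(p ! j, p ! Suc j) \<notin> D" if j: "Suc j < length p"
  proof
    assume d: "(p ! j, p ! Suc j) \<in> D"
    have o: "p ! Suc j \<in> Co" if "i + k = Suc j" "odd k" for k
    proof -
      have "even (j - i)" using that ij by presburger
      then show ?thesis using d sidee[of j] disj ij by (auto simp: D_def)
    qed
    have e: "p ! Suc j \<in> Ce" if "i + k = Suc j" "even k" for k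
    proof -
      have "odd (j - i)" using that ij by presburger
      then show ?thesis using d sideo[of j] disj ij by (auto simp: D_def)
    qed
    have "parity_split (remove_path_edges G p) (subpath p i (Suc j))"
      unfolding split_conv
    proof (intro bexI conjI allI impI)
      show "(a, b) \<notin> ?R" by (rule ab)
      fix k assume k: "k < length (subpath p i (Suc j))"
      then have k': "k < Suc (Suc j) - i" using j by (simp add: length_subpath)
      then have c: "i + k \<le> j \<or> i + k = Suc j" by linarith
      show "(a, subpath p i (Suc j) ! k) \<in> ?R" if "odd k"
        using c sideo[of "i + k"] o[of k] that k' j by (auto simp: nth_subpath Co_def)
      show "(b, subpath p i (Suc j) ! k) \<in> ?R" if "even k"
        using c sidee[of "i + k"] e[of k] that k' j by (auto simp: nth_subpath Ce_def)
    qed (use ab in auto)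
    moreover have "subpath p i (Suc j) \<noteq> subpath p i j"
      using ij j length_subpath[of j p i] length_subpath[of "Suc j" p i] by (intro notI) simp
    moreover have "path_contains (subpath p i (Suc j)) (subpath p i j)"
      using ij j by (intro path_contains_subpathI) auto
    ultimately show False using max[of i "Suc j"] ij j by linarith
  qed
  have "even_on_triangles ?E (D \<inter> path_edges p i j)"
    by (rule even_on_triangles_restrict[OF dist _ _ _ _ irr symE evenD DQ])
      (use ij left right in auto)
  moreover have "(p ! i, p ! Suc i) \<in> D \<inter> path_edges p i j"
    using edge ij by (auto intro: path_edgeI)
  ultimately have "(p ! i, p ! Suc i) \<notin> (?E - (D \<inter> path_edges p i j))\<^sup>*"
    by (rule even_on_triangles_separates[OF ch])
  moreover have "(?E - path_edges p i j)\<^sup>* \<subseteq> (?E - (D \<inter> path_edges p i j))\<^sup>*"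
    by (rule rtrancl_mono) auto
  ultimately have sep: "separating_path G (subpath p i j)"
    using sep_conv[of i j] ij edge[of i] wf by (auto simp: D_def)
  have min: "x = i \<and> y = j"
    if xy: "i \<le> x" "x \<le> y" "y \<le> j" and s: "separating_path G (subpath p x y)" for x y
  proof (rule ccontr)
    assume ne: "\<not> ?thesis"
    let ?H = "?E - path_edges p x y"
    have symH: "sym (?H\<^sup>*)" using symE sym_path_edges[of p x y]
      by (intro sym_rtrancl) (auto simp: sym_def)
    have "path_edges p x y \<subseteq> ?Q" using xy ij by (intro path_edges_mono) auto
    then have RH: "?R \<subseteq> ?H\<^sup>*" by (intro rtrancl_mono) auto
    \<comment> \<open>An edge of the subpath from \<open>i\<close> to \<open>j\<close> that the
      proper part from \<open>x\<close> to \<open>y\<close> omits: the first one if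
      \<open>i < x\<close>, and otherwise the last one, since then \<open>y < j\<close>.\<close>
    define k where "k = (if i < x then i else j - 1)"
    have k: "i \<le> k" "k < j" "k < x \<or> y \<le> k" using ne xy ij by (auto simp: k_def)
    have "(p ! k, p ! Suc k) \<notin> path_edges p x y"
      using path_edges_nth[OF dist, of y k "Suc k" x] k xy ij by auto
    then have kH: "(p ! k, p ! Suc k) \<in> ?H" using edge[OF k(1,2)] by (auto simp: D_def)
    \<comment> \<open>The kept edge joins \<open>Co\<close> to \<open>Ce\<close>, so
      \<open>a\<close> reaches \<open>b\<close> and with it every vertex of the subpath. Each
      removed edge can therefore be bypassed, and the graph stays connected.\<close>
    obtain c d where cd: "(c, d) \<in> ?H\<^sup>*" "c \<in> Co" "d \<in> Ce"
      using edge[OF k(1,2)] kH symH by (auto simp: D_def dest: symD)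
    have "(a, c) \<in> ?H\<^sup>*" "(b, d) \<in> ?H\<^sup>*" using cd RH by (auto simp: Co_def Ce_def)
    then have "(a, b) \<in> ?H\<^sup>*" using cd(1) symH by (meson rtrancl_trans symD)
    then have aH: "(a, p ! m) \<in> ?H\<^sup>*" if "i \<le> m" "m \<le> j" for m
      using sideo[OF that] sidee[OF that] RH unfolding Co_def Ce_def
      by (cases "odd (m - i)") (auto intro: rtrancl_trans)
    have "?E \<subseteq> ?H\<^sup>*"
    proof (rule subrelI)
      fix s t assume st: "(s, t) \<in> ?E"
      show "(s, t) \<in> ?H\<^sup>*"
      proof (cases "(s, t) \<in> path_edges p x y")
        case True
        have "y < length p" using xy ij by linarith
        then obtain m m' where m: "s = p ! m" "t = p ! m'" "x \<le> m" "m \<le> y" "x \<le> m'" "m' \<le> y"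
          using path_edges_obtain[OF True] by metis
        then have "(a, s) \<in> ?H\<^sup>*" "(a, t) \<in> ?H\<^sup>*" using aH[of m] aH[of m'] xy by auto
        then show ?thesis using symH by (meson rtrancl_trans symD)
      qed (use st in auto)
    qed
    then have "?E\<^sup>* \<subseteq> ?H\<^sup>*" by (rule rtrancl_subset_rtrancl)
    then show False using s sep_conv[of x y] conE xy ij by auto
  qed
  have "vpath (subpath p i j) G"
    using vwalk_subpath[OF walk _ ij(2), of i] ij dist by (auto simp: vpath_def subpath_def)
  then show ?thesis
    unfolding separator_path_def using sep min ij by (auto simp: path_contains_subpath_iff)
qed

theorem theorem12:
  fixes G G3 :: "'a pair_pre_digraph" and P0 :: "'a list"
  assumes "chordal G" and "connected G"
    and "vpath P0 G"
    and "G3 = remove_path_edges G P0"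
  shows
    "(\<forall>i j. i < j \<and> j < length P0 \<and> separator_path G (subpath P0 i j)
        \<longrightarrow> parity_split G3 (subpath P0 i j)) \<and>
     (\<forall>i j. i < j \<and> j < length P0 \<and> parity_split G3 (subpath P0 i j) \<and>
        \<not> (\<exists>x y. x < y \<and> y < length P0 \<and>
              subpath P0 x y \<noteq> subpath P0 i j \<and>
              path_contains (subpath P0 x y) (subpath P0 i j) \<and>
              parity_split G3 (subpath P0 x y))
        \<longrightarrow> separator_path G (subpath P0 i j))"
proof (intro conjI allI impI; elim conjE)
  fix i j assume "i < j" "j < length P0" "separator_path G (subpath P0 i j)"
  then show "parity_split G3 (subpath P0 i j)"
    unfolding assms(4) by (rule separator_imp_parity_split[OF assms(1-3)])
next
  fix i j assume ij: "i < j" "j < length P0" and split: "parity_split G3 (subpath P0 i j)"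
    and max: "\<not> (\<exists>x y. x < y \<and> y < length P0 \<and> subpath P0 x y \<noteq> subpath P0 i j \<and>
      path_contains (subpath P0 x y) (subpath P0 i j) \<and> parity_split G3 (subpath P0 x y))"
  show "separator_path G (subpath P0 i j)"
  proof (rule maximal_parity_split_imp_separator[OF assms(1-3) ij])
    show "\<not> parity_split (remove_path_edges G P0) (subpath P0 x y)"
      if "x < y" "y < length P0" "subpath P0 x y \<noteq> subpath P0 i j"
        "path_contains (subpath P0 x y) (subpath P0 i j)" for x y
      using max that unfolding assms(4) by metis
  qed (use split assms(4) in simp)
qed

end
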